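(* The Okubic plane $\mathcal{O}P^2=\{\mathscr{P}_{\mathcal{O}},\mathscr{L}_{\mathcal{O}},\subseteq\}$, defined by Veronese vectors, is a projective plane and is isomorphic (by bijections of points and of lines preserving incidence) to the completion $\overline{\mathscr{A}_2}(\mathcal{O})$ of the Okubic affine plane.
   Context: The real Okubo algebra $\mathcal{O}$ is the 8-dimensional real vector space of $3\times 3$ complex Hermitian traceless matrices with bilinear product $x*y=\mu\,xy+\overline{\mu}\,yx-\frac13\mathrm{Tr}(xy)\,I$, where $\mu=\frac16(3+\mathrm{i}\sqrt3)$, and norm $n(x)=\frac16\mathrm{Tr}(x^2)$, with polar form $\langle x,y\rangle=n(x+y)-n(x)-n(y)$. Veronese description. Let $V=\mathcal{O}^3\times\mathbb{R}^3$, with elements $(x_1,x_2,x_3;\lambda_1,\lambda_2,\lambda_3)$. The set $H\subset V$ of Veronese vectors consists of the elements satisfying $$\lambda_1x_1=x_2*x_3,\quad\lambda_2x_2=x_3*x_1,\quad\lambda_3x_3=x_1*x_2,$$ $$n(x_1)=\lambda_2\lambda_3,\quad n(x_2)=\lambda_3\lambda_1,\quad n(x_3)=\lambda_1\lambda_2.$$ On $V$ let $\beta(v,w)=\sum_{\nu=1}^3(\langle x_\nu,y_\nu\rangle+\lambda_\nu\eta_\nu)$ for $v=(x_\nu;\lambda_\nu)_\nu$, $w=(y_\nu;\eta_\nu)_\nu$. The points are $\mathscr{P}_{\mathcal{O}}=\{\mathbb{R}w:w\in H\smallsetminus\{0\}\}$; the lines $\mathscr{L}_{\mathcal{O}}$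 are the sets $\ell_w=w^\perp=\{z\in H:\beta(z,w)=0\}$ for $w\in H\smallsetminus\{0\}$; the point $\mathbb{R}v$ is incident to $\ell_w$ iff $\mathbb{R}v\subseteq\ell_w$, i.e. $\beta(v,w)=0$. Completed affine plane $\overline{\mathscr{A}_2}(\mathcal{O})$. Points: $(x,y)\in\mathcal{O}^2$; $(s)$ for $s\in\mathcal{O}$; $(\infty)$. Lines: $[s,t]=\{(x,s*x+t):x\in\mathcal{O}\}\cup\{(s)\}$ for $s,t\in\mathcal{O}$; $[c]=(\{c\}\times\mathcal{O})\cup\{(\infty)\}$ for $c\in\mathcal{O}$; $[\infty]=\{(s):s\in\mathcal{O}\}\cup\{(\infty)\}$. Incidence is membership. A projective plane is an incidence structure in which any two distinct points are incident to a unique line, any two distinct lines are incident to a unique common point, and there exist four points no three of which are incident to a common line. *)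

theory Defs
  imports "HOL-Analysis.Analysis"
begin

section \<open>Incidence structures\<close>

definition projective_plane :: "'p set \<Rightarrow> 'l set \<Rightarrow> ('p \<Rightarrow> 'l \<Rightarrow> bool) \<Rightarrow> bool" where
  "projective_plane P L I \<longleftrightarrow>
     (\<forall>p\<in>P. \<forall>q\<in>P. p \<noteq> q \<longrightarrow> (\<exists>!l. l \<in> L \<and> I p l \<and> I q l)) \<and>
     (\<forall>l\<in>L. \<forall>m\<in>L. l \<noteq> m \<longrightarrow> (\<exists>!p. p \<in> P \<and> I p l \<and> I p m)) \<and>
     (\<exists>Q\<subseteq>P. card Q = 4 \<and>
        (\<forall>T\<subseteq>Q. card T = 3 \<longrightarrow> \<not> (\<exists>l\<in>L. \<forall>p\<in>T. I p l)))"

definition incidence_isomorphic ::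
  "'p set \<Rightarrow> 'l set \<Rightarrow> ('p \<Rightarrow> 'l \<Rightarrow> bool) \<Rightarrow> 'q set \<Rightarrow> 'm set \<Rightarrow> ('q \<Rightarrow> 'm \<Rightarrow> bool) \<Rightarrow> bool" where
  "incidence_isomorphic P L I P' L' I' \<longleftrightarrow>
     (\<exists>f g. bij_betw f P P' \<and> bij_betw g L L' \<and>
        (\<forall>p\<in>P. \<forall>l\<in>L. I p l \<longleftrightarrow> I' (f p) (g l)))"


section \<open>The real Okubo algebra\<close>

type_synonym mat3 = "complex^3^3"

definition okubo :: "mat3 set" where
  "okubo = {A. (\<forall>i j. A $ i $ j = cnj (A $ j $ i)) \<and> trace A = 0}"

definition okubo_mu :: complex where
  "okubo_mu = (3 + \<i> * of_real (sqrt 3)) / 6"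

text \<open>The matrix \<^term>\<open>mat c\<close> is \<open>c\<close> times the identity, so
  \<^term>\<open>mat c ** A\<close> is the complex scalar multiple \<open>c A\<close>.\<close>

definition okubo_mult :: "mat3 \<Rightarrow> mat3 \<Rightarrow> mat3"  (infixl "\<star>" 70) where
  "x \<star> y = mat okubo_mu ** (x ** y) + mat (cnj okubo_mu) ** (y ** x) - mat (trace (x ** y) / 3)"

text \<open>On \<^const>\<open>okubo\<close> the trace of \<open>x\<^sup>2\<close> is real (see \<open>trace_square_real\<close> below),
  so taking the real part only changes the type.\<close>

definition okubo_norm :: "mat3 \<Rightarrow> real" where
  "okubo_norm x = Re (trace (x ** x)) / 6"

definition okubo_polar :: "mat3 \<Rightarrow> mat3 \<Rightarrow> real" where
  "okubo_polar x y = okubo_norm (x + y) - okubo_norm x - okubo_norm y"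

lemma okubo_cnj:
  assumes "A \<in> okubo"
  shows "cnj (A $ i $ j) = A $ j $ i"
proof -
  have "A $ j $ i = cnj (A $ i $ j)" using assms unfolding okubo_def by blast
  thus ?thesis by (rule sym)
qed

lemma okubo_trace: "A \<in> okubo \<Longrightarrow> trace A = 0"
  unfolding okubo_def by blast

lemma okuboI:
  assumes "\<And>i j. A $ i $ j = cnj (A $ j $ i)" and "trace A = 0"
  shows "A \<in> okubo"
  unfolding okubo_def using assms by blast

lemma subspace_okubo: "subspace okubo"
proof (rule subspaceI)
  show "0 \<in> okubo" by (rule okuboI) (simp_all add: trace_def)
next
  fix x y assume "x \<in> okubo" "y \<in> okubo"
  thus "x + y \<in> okubo" by (intro okuboI) (simp_all add: okubo_cnj okubo_trace trace_add)
next
  fix c x assume x: "x \<in> okubo"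
  have "trace (c *\<^sub>R x) = c *\<^sub>R trace x" by (simp add: trace_def scaleR_sum_right)
  thus "c *\<^sub>R x \<in> okubo" using x by (intro okuboI) (simp_all add: okubo_cnj okubo_trace)
qed

lemma hermitian_mult:
  fixes x y :: mat3
  assumes "x \<in> okubo" "y \<in> okubo"
  shows "cnj ((x ** y) $ j $ i) = (y ** x) $ i $ j"
proof -
  have "cnj ((x ** y) $ j $ i) = (\<Sum>k\<in>UNIV. cnj (x $ j $ k) * cnj (y $ k $ i))"
    by (simp add: matrix_matrix_mult_def)
  also have "\<dots> = (\<Sum>k\<in>UNIV. y $ i $ k * x $ k $ j)"
    by (simp only: okubo_cnj[OF assms(1)] okubo_cnj[OF assms(2)] mult.commute)
  also have "\<dots> = (y ** x) $ i $ j"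
    by (simp add: matrix_matrix_mult_def)
  finally show ?thesis .
qed

lemma trace_mult_real:
  assumes "x \<in> okubo" "y \<in> okubo"
  shows "cnj (trace (x ** y)) = trace (x ** y)"
proof -
  have "cnj (trace (x ** y)) = trace (y ** x)"
    unfolding trace_def by (simp add: hermitian_mult[OF assms])
  also have "\<dots> = trace (x ** y)" by (rule trace_mul_sym)
  finally show ?thesis .
qed

lemma trace_square_real:
  assumes "x \<in> okubo"
  shows "trace (x ** x) \<in> \<real>"
  using trace_mult_real[OF assms assms] by (simp add: Reals_cnj_iff)

lemma mat_mult_nth: "(mat c ** A) $ i $ j = c * (A :: mat3) $ i $ j"
proof -
  have "(mat c ** A) $ i $ j = (\<Sum>k\<in>UNIV. if i = k then c * A $ k $ j else 0)"
    unfolding matrix_matrix_mult_def mat_def vec_lambda_beta by (rule sum.cong) simp_all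
  also have "\<dots> = c * A $ i $ j" by simp
  finally show ?thesis .
qed

lemma okubo_mult_closed:
  assumes x: "x \<in> okubo" and y: "y \<in> okubo"
  shows "x \<star> y \<in> okubo"
proof -
  have mu: "okubo_mu + cnj okubo_mu = 1"
    by (simp add: okubo_mu_def complex_eq_iff)
  have tr: "trace (mat c ** A) = c * trace A" for c and A :: mat3
    by (simp add: trace_def mat_mult_nth sum_distrib_left)
  have "trace (x \<star> y) = (okubo_mu + cnj okubo_mu) * trace (x ** y) - trace (x ** y)"
    unfolding okubo_mult_def
    by (simp add: trace_add trace_sub tr trace_mul_sym[of y x] algebra_simps)
      (simp add: trace_def mat_def)
  hence "trace (x \<star> y) = 0" by (simp add: mu)
  moreover have "(x \<star> y) $ i $ j = cnj ((x \<star> y) $ j $ i)" for i j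
    unfolding okubo_mult_def
    by (simp add: mat_mult_nth hermitian_mult[OF x y] hermitian_mult[OF y x])
      (simp add: mat_def trace_mult_real[OF x y])
  ultimately show ?thesis by (intro okuboI)
qed


section \<open>The Okubic plane via Veronese vectors\<close>

type_synonym veronese = "(mat3^3) \<times> (real^3)"

definition veronese_space :: "veronese set" where
  "veronese_space = {(x, l). \<forall>i. x $ i \<in> okubo}"

definition veronese_vectors :: "veronese set" where
  "veronese_vectors = {(x, l) \<in> veronese_space.
     l$1 *\<^sub>R x$1 = x$2 \<star> x$3 \<and> l$2 *\<^sub>R x$2 = x$3 \<star> x$1 \<and> l$3 *\<^sub>R x$3 = x$1 \<star> x$2 \<and>
     okubo_norm (x$1) = l$2 * l$3 \<and> okubo_norm (x$2) = l$3 * l$1 \<and> okubo_norm (x$3) = l$1 * l$2}"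

definition veronese_form :: "veronese \<Rightarrow> veronese \<Rightarrow> real" where
  "veronese_form v w =
     (\<Sum>i\<in>UNIV. okubo_polar (fst v $ i) (fst w $ i) + snd v $ i * snd w $ i)"

definition veronese_point :: "veronese \<Rightarrow> veronese set" where
  "veronese_point w = {c *\<^sub>R w | c. True}"

definition veronese_line :: "veronese \<Rightarrow> veronese set" where
  "veronese_line w = {z \<in> veronese_vectors. veronese_form z w = 0}"

definition okubic_points :: "veronese set set" where
  "okubic_points = veronese_point ` (veronese_vectors - {0})"

definition okubic_lines :: "veronese set set" where
  "okubic_lines = veronese_line ` (veronese_vectors - {0})"


section \<open>The completed Okubic affine plane\<close>

datatype completed_point = Affine mat3 mat3 | Slope mat3 | Infinity

definition completed_points :: "completed_point set" where
  "completed_points =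
     {Affine x y | x y. x \<in> okubo \<and> y \<in> okubo} \<union> Slope ` okubo \<union> {Infinity}"

definition slope_line :: "mat3 \<Rightarrow> mat3 \<Rightarrow> completed_point set" where
  "slope_line s t = {Affine x (s \<star> x + t) | x. x \<in> okubo} \<union> {Slope s}"

definition vertical_line :: "mat3 \<Rightarrow> completed_point set" where
  "vertical_line c = {Affine c y | y. y \<in> okubo} \<union> {Infinity}"

definition line_at_infinity :: "completed_point set" where
  "line_at_infinity = Slope ` okubo \<union> {Infinity}"

definition completed_lines :: "completed_point set set" where
  "completed_lines =
     {slope_line s t | s t. s \<in> okubo \<and> t \<in> okubo} \<union> vertical_line ` okubo \<union> {line_at_infinity}"

end

theory Submission
  imports Defs
begin

text \<open>
  The Okubo product satisfies \<open>(x \<star> y) \<star> x = n(x) y = x \<star> (y \<star> x)\<close>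
  (\<open>okubo_symmetric_composition\<close>), and the polar form is associative,
  \<open>\<langle>x \<star> y, z\<rangle> = \<langle>x, y \<star> z\<rangle>\<close> (\<open>okubo_polar_assoc\<close>). Together these make the norm
  multiplicative; it is also positive definite, so both equations \<open>a \<star> x = b\<close> and
  \<open>x \<star> a = b\<close> have exactly one solution when \<open>a \<noteq> 0\<close> (\<open>okubo_division\<close>). Unique
  division turns the completed affine plane into a projective plane
  (\<open>projective_plane_completed\<close>), just as over a division ring.

  The same identities show that the vectors
  \<open>(x, y, x \<star> y; n(y), n(x), 1)\<close>, \<open>(0, 0, s; n(s), 1, 0)\<close>, \<open>(0, 0, 0; 1, 0, 0)\<close>
  are Veronese, and by normalising the last nonzero \<open>\<lambda>\<close>-coordinate to 1 every nonzero
  Veronese vector is a multiple of exactly one of them: these are the points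
  \<open>(x, y)\<close>, \<open>(s)\<close>, \<open>(\<infinity>)\<close>. Normalising the first nonzero \<open>\<lambda>\<close>-coordinate instead gives
  \<open>(t \<star> s, -t, -s; 1, n(s), n(t))\<close>, \<open>(-c, 0, 0; 0, 1, n(c))\<close>, \<open>(0, 0, 0; 0, 0, 1)\<close>,
  and the lines orthogonal to these vectors are \<open>[s, t]\<close>, \<open>[c]\<close>, \<open>[\<infinity>]\<close>. The reason is that
  the form of the vectors belonging to \<open>(x, y)\<close> and \<open>[s, t]\<close> expands to
  \<open>n(y - (s \<star> x + t))\<close> (\<open>veronese_form_affine\<close>), which by definiteness vanishes
  precisely when the point lies on the line; the remaining incidences are degenerate cases of
  this. So the two planes are isomorphic, and the axioms pass from the affine model to the
  Veronese model.
\<close>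

section \<open>The Okubo algebra as a symmetric composition algebra\<close>

lemma trace_mult_3: "trace ((x::mat3) ** y) = (\<Sum>i\<in>UNIV. \<Sum>j\<in>UNIV. x $ i $ j * y $ j $ i)"
  by (simp add: trace_def matrix_matrix_mult_def)

lemma bilinear_matrix_mult: "bilinear ((**) :: mat3 \<Rightarrow> mat3 \<Rightarrow> mat3)"
  unfolding bilinear_def
  by (auto intro!: linearI simp: vec_eq_iff matrix_matrix_mult_def algebra_simps sum.distrib scaleR_sum_right)

lemma linear_trace: "linear (trace :: mat3 \<Rightarrow> complex)"
  by (intro linearI) (simp_all add: trace_def sum.distrib scaleR_sum_right)

lemma okubo_mult_nth:
  "(x \<star> y) $ i $ j = okubo_mu * (x ** y) $ i $ j + cnj okubo_mu * (y ** x) $ i $ j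
     - (if i = j then trace (x ** y) / 3 else 0)"
  unfolding okubo_mult_def by (simp only: vector_add_component vector_minus_component mat_mult_nth) (simp add: mat_def)

lemma bilinear_okubo_mult: "bilinear (\<star>)"
proof -
  note m = bilinear_ladd[OF bilinear_matrix_mult] bilinear_radd[OF bilinear_matrix_mult]
    bilinear_lmul[OF bilinear_matrix_mult] bilinear_rmul[OF bilinear_matrix_mult]
    linear_add[OF linear_trace] linear_scale[OF linear_trace]
  show ?thesis
    unfolding bilinear_def
    by (auto intro!: linearI simp: vec_eq_iff okubo_mult_nth m algebra_simps add_divide_distrib)
qed

lemma okubo_polar_trace: "okubo_polar x y = Re (trace (x ** y)) / 3"
proof -
  have "trace ((x + y) ** (x + y)) = trace (x ** x) + 2 * trace (x ** y) + trace (y ** y)"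
    by (simp add: bilinear_ladd[OF bilinear_matrix_mult] bilinear_radd[OF bilinear_matrix_mult]
        trace_add trace_mul_sym[of y x])
  thus ?thesis by (simp add: okubo_polar_def okubo_norm_def field_simps)
qed

lemma bilinear_okubo_polar: "bilinear okubo_polar"
proof -
  note m = bilinear_ladd[OF bilinear_matrix_mult] bilinear_radd[OF bilinear_matrix_mult]
    bilinear_lmul[OF bilinear_matrix_mult] bilinear_rmul[OF bilinear_matrix_mult]
    linear_add[OF linear_trace] linear_scale[OF linear_trace]
  show ?thesis
    unfolding bilinear_def
    by (auto intro!: linearI simp: okubo_polar_trace m add_divide_distrib)
qed

lemma okubo_polar_commute: "okubo_polar x y = okubo_polar y x"
  by (simp add: okubo_polar_trace trace_mul_sym[of y x])

lemma okubo_polar_self: "okubo_polar x x = 2 * okubo_norm x"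
  by (simp add: okubo_polar_trace okubo_norm_def)

text \<open>For a Hermitian matrix, the trace of the square is the sum of the squared moduli of the entries.\<close>
lemma okubo_norm_eq_0:
  assumes "x \<in> okubo" shows "okubo_norm x = 0 \<longleftrightarrow> x = 0"
proof
  assume 0: "okubo_norm x = 0"
  have "trace (x ** x) = (\<Sum>i\<in>UNIV. \<Sum>j\<in>UNIV. x $ i $ j * cnj (x $ i $ j))"
    by (simp add: trace_mult_3 okubo_cnj[OF assms])
  hence "(\<Sum>i\<in>UNIV. \<Sum>j\<in>UNIV. (cmod (x $ i $ j))\<^sup>2) = 0"
    using 0 by (simp add: okubo_norm_def complex_mult_cnj cmod_power2)
  hence "x $ i $ j = 0" for i j
    by (simp add: sum_nonneg_eq_0_iff sum_nonneg)
  thus "x = 0" by (simp add: vec_eq_iff)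
qed (simp add: okubo_norm_def trace_def)

text \<open>A traceless \<open>3 \<times> 3\<close> matrix satisfies \<open>x\<^sup>3 = (1/2) tr(x\<^sup>2) x + det(x) I\<close>. The statement
  is the part linear in \<open>y\<close> of this equation at \<open>x + y\<close>, cleared of denominators; since both sides
  are explicit polynomials, substituting the last diagonal entry verifies it.\<close>
lemma cayley_hamilton_linearised:
  fixes x y :: mat3
  assumes "trace x = 0" "trace y = 0"
  shows "2 * ((x ** x) ** y + (x ** y) ** x + (y ** x) ** x) $ i $ j =
    trace (x ** x) * y $ i $ j + 2 * trace (x ** y) * x $ i $ j
      + (if i = j then 2 * trace ((x ** x) ** y) else 0)"
proof -
  have x: "x $ 3 $ 3 = - x $ 1 $ 1 - x $ 2 $ 2" and y: "y $ 3 $ 3 = - y $ 1 $ 1 - y $ 2 $ 2"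
    using assms by (auto simp: trace_def sum_3 add_eq_0_iff algebra_simps)
  have "\<forall>i j. 2 * ((x ** x) ** y + (x ** y) ** x + (y ** x) ** x) $ i $ j =
    trace (x ** x) * y $ i $ j + 2 * trace (x ** y) * x $ i $ j
      + (if i = j then 2 * trace ((x ** x) ** y) else 0)"
    by (simp add: forall_3 matrix_matrix_mult_def trace_def sum_3 x y) (simp add: algebra_simps)
  thus ?thesis by blast
qed

text \<open>The scalar \<open>\<mu>\<close> enters the composition identities only through these three symmetric expressions
  in \<open>\<mu>\<close> and its conjugate.\<close>
lemma okubo_mu: "okubo_mu + cnj okubo_mu = 1" "okubo_mu * cnj okubo_mu = 1 / 3"
  "okubo_mu\<^sup>2 + (cnj okubo_mu)\<^sup>2 = 1 / 3"
  by (simp_all add: okubo_mu_def complex_eq_iff power2_eq_square field_simps)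


lemma okubo_mult_matrix_nth:
  "((x \<star> y) ** z) $ i $ j = okubo_mu * ((x ** y) ** z) $ i $ j + cnj okubo_mu * ((y ** x) ** z) $ i $ j
     - trace (x ** y) / 3 * z $ i $ j"
  "(z ** (x \<star> y)) $ i $ j = okubo_mu * (z ** (x ** y)) $ i $ j + cnj okubo_mu * (z ** (y ** x)) $ i $ j
     - trace (x ** y) / 3 * z $ i $ j"
proof -
  have "(z ** (mat c ** w)) $ i $ j = c * (z ** w) $ i $ j" for c i j and w :: mat3
    unfolding matrix_matrix_mult_def[of z] by (simp add: mat_mult_nth sum_distrib_left mult.left_commute)
  hence central: "z ** (mat c ** w) = mat c ** (z ** w)" for c and w :: mat3
    by (simp add: vec_eq_iff mat_mult_nth)
  have "z ** (mat c) = mat c ** z" for c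
    using central[of c "mat 1"] by simp
  thus "(z ** (x \<star> y)) $ i $ j = okubo_mu * (z ** (x ** y)) $ i $ j + cnj okubo_mu * (z ** (y ** x)) $ i $ j
     - trace (x ** y) / 3 * z $ i $ j"
    by (simp add: okubo_mult_def bilinear_radd[OF bilinear_matrix_mult]
        bilinear_rsub[OF bilinear_matrix_mult] central mat_mult_nth)
  show "((x \<star> y) ** z) $ i $ j = okubo_mu * ((x ** y) ** z) $ i $ j + cnj okubo_mu * ((y ** x) ** z) $ i $ j
     - trace (x ** y) / 3 * z $ i $ j"
    by (simp add: okubo_mult_def bilinear_ladd[OF bilinear_matrix_mult]
        bilinear_lsub[OF bilinear_matrix_mult] matrix_mul_assoc[symmetric] mat_mult_nth)
qed

lemma trace_okubo_mult_matrix: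
  "trace ((x \<star> y) ** z) = okubo_mu * trace ((x ** y) ** z) + cnj okubo_mu * trace ((y ** x) ** z)
     - trace (x ** y) / 3 * trace z"
  "trace (z ** (x \<star> y)) = okubo_mu * trace (z ** (x ** y)) + cnj okubo_mu * trace (z ** (y ** x))
     - trace (x ** y) / 3 * trace z"
  unfolding trace_def[of "(x \<star> y) ** z"] trace_def[of "z ** (x \<star> y)"]
  by (simp_all only: okubo_mult_matrix_nth)
    (simp_all add: trace_def sum.distrib sum_subtractf sum_distrib_left)

text \<open>Both sides are the same combination of traces of triple products, by cyclicity of the trace.\<close>
lemma okubo_polar_assoc:
  assumes "x \<in> okubo" "y \<in> okubo" "z \<in> okubo"
  shows "okubo_polar (x \<star> y) z = okubo_polar x (y \<star> z)"
proof -
  have "trace ((y ** x) ** z) = trace (x ** (z ** y))"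
    by (metis matrix_mul_assoc trace_mul_sym)
  thus ?thesis
    by (simp add: okubo_polar_trace trace_okubo_mult_matrix assms[THEN okubo_trace] matrix_mul_assoc)
qed

text \<open>Expanding \<open>(x \<star> y) \<star> x\<close> for traceless matrices gives the coefficient \<open>\<mu>\<^sup>2 + \<mu>'\<^sup>2\<close> on
  \<open>xyx\<close> and \<open>\<mu>\<mu>'\<close> on \<open>x\<^sup>2y\<close> and \<open>yx\<^sup>2\<close>, where \<open>\<mu>'\<close> is the conjugate of \<open>\<mu>\<close>. The value of \<open>\<mu>\<close>
  makes all of them equal to \<open>1/3\<close>, so that the linearised Cayley--Hamilton identity
  collapses the sum to a multiple of \<open>y\<close>. The other product is the same computation with
  \<open>\<mu>\<close> and \<open>\<mu>'\<close> exchanged.\<close>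
lemma okubo_symmetric_composition:
  assumes x: "x \<in> okubo" and y: "y \<in> okubo"
  shows "(x \<star> y) \<star> x = okubo_norm x *\<^sub>R y" "x \<star> (y \<star> x) = okubo_norm x *\<^sub>R y"
proof -
  have norm: "complex_of_real (okubo_norm x) = trace (x ** x) / 6"
    using trace_square_real[OF x] by (simp add: okubo_norm_def complex_eq_iff complex_is_Real_iff)
  have scaleR_nth: "(r *\<^sub>R y) $ i $ j = complex_of_real r * y $ i $ j" for r i j
    by (simp only: vector_scaleR_component) (simp add: scaleR_conv_of_real)
  have t: "trace (x ** y ** x) = trace (x ** x ** y)" "trace (y ** x ** x) = trace (x ** x ** y)"
    by (metis matrix_mul_assoc trace_mul_sym)+
  \<comment> \<open>\<open>a\<close>, \<open>b\<close>, \<open>c\<close> stand for entries of \<open>x\<^sup>2y\<close>, \<open>xyx\<close>, \<open>yx\<^sup>2\<close>;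
    \<open>d\<close>, \<open>f\<close>, \<open>g\<close> for the traces of \<open>xy\<close>, \<open>x\<^sup>2y\<close>, \<open>x\<^sup>2\<close>; \<open>e\<close>, \<open>h\<close> for entries of \<open>x\<close>, \<open>y\<close>.\<close>
  have *: "m * (m * b + n * c - d / 3 * e) + n * (m * a + n * b - d / 3 * e) - (if P then f / 3 else 0) = g / 6 * h"
    if mn: "m + n = 1" "m * n = 1 / 3" "m\<^sup>2 + n\<^sup>2 = 1 / 3"
      and ch: "2 * (a + b + c) = g * h + 2 * d * e + (if P then 2 * f else 0)"
    for a b c d e f g h m n :: complex and P
  proof -
    have "m * (m * b + n * c - d / 3 * e) + n * (m * a + n * b - d / 3 * e)
        = m * n * (a + c) + (m\<^sup>2 + n\<^sup>2) * b - (m + n) * (d * e / 3)"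
      by (simp add: algebra_simps power2_eq_square)
    also have "\<dots> = (2 * (a + b + c) - 2 * d * e) / 6"
      unfolding mn by (simp add: field_simps)
    finally show ?thesis unfolding ch by (simp add: field_simps)
  qed
  have mu': "cnj okubo_mu + okubo_mu = 1" "cnj okubo_mu * okubo_mu = 1 / 3"
    "(cnj okubo_mu)\<^sup>2 + okubo_mu\<^sup>2 = 1 / 3"
    using okubo_mu by (simp_all add: add.commute mult.commute)
  note ch = cayley_hamilton_linearised[OF x[THEN okubo_trace] y[THEN okubo_trace], unfolded vector_add_component]
  have f: "okubo_mu * s + cnj okubo_mu * s = s" for s
    by (simp add: distrib_right[symmetric] okubo_mu)
  have tr: "trace ((x \<star> y) ** x) = trace (x ** x ** y)" "trace (x ** (y \<star> x)) = trace (x ** x ** y)"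
    by (simp_all add: trace_okubo_mult_matrix matrix_mul_assoc t f x[THEN okubo_trace])
  have "((x \<star> y) \<star> x) $ i $ j = trace (x ** x) / 6 * y $ i $ j" for i j
    unfolding okubo_mult_nth[of "x \<star> y"] okubo_mult_matrix_nth tr
    unfolding matrix_mul_assoc
    by (rule *[OF okubo_mu ch])
  thus "(x \<star> y) \<star> x = okubo_norm x *\<^sub>R y"
    by (simp only: vec_eq_iff scaleR_nth norm) simp
  have "(x \<star> (y \<star> x)) $ i $ j = trace (x ** x) / 6 * y $ i $ j" for i j
    unfolding okubo_mult_nth[of x] okubo_mult_matrix_nth tr
    using *[OF mu' ch[of i j]] 
    by (simp add: matrix_mul_assoc trace_mul_sym[of y x] add_ac)
  thus "x \<star> (y \<star> x) = okubo_norm x *\<^sub>R y"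
    by (simp only: vec_eq_iff scaleR_nth norm) simp
qed

text \<open>By associativity of the form, \<open>2 n(x \<star> y) = \<langle>x, y \<star> (x \<star> y)\<rangle> = \<langle>x, n(y) x\<rangle>\<close>.\<close>
lemma okubo_norm_mult:
  assumes "x \<in> okubo" "y \<in> okubo"
  shows "okubo_norm (x \<star> y) = okubo_norm x * okubo_norm y"
proof -
  have "2 * okubo_norm (x \<star> y) = okubo_polar x (y \<star> (x \<star> y))"
    using assms by (simp add: okubo_polar_self[symmetric] okubo_polar_assoc okubo_mult_closed)
  also have "\<dots> = 2 * (okubo_norm x * okubo_norm y)"
    using assms by (simp add: okubo_symmetric_composition bilinear_rmul[OF bilinear_okubo_polar] okubo_polar_self)
  finally show ?thesis by simp
qed

lemmas okubo_mult_bilinear =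
  bilinear_ladd[OF bilinear_okubo_mult] bilinear_radd[OF bilinear_okubo_mult]
  bilinear_lsub[OF bilinear_okubo_mult] bilinear_rsub[OF bilinear_okubo_mult]
  bilinear_lneg[OF bilinear_okubo_mult] bilinear_rneg[OF bilinear_okubo_mult]
  bilinear_lmul[OF bilinear_okubo_mult] bilinear_rmul[OF bilinear_okubo_mult]
  bilinear_lzero[OF bilinear_okubo_mult] bilinear_rzero[OF bilinear_okubo_mult]

lemmas okubo_polar_bilinear =
  bilinear_ladd[OF bilinear_okubo_polar] bilinear_radd[OF bilinear_okubo_polar]
  bilinear_lsub[OF bilinear_okubo_polar] bilinear_rsub[OF bilinear_okubo_polar]
  bilinear_lneg[OF bilinear_okubo_polar] bilinear_rneg[OF bilinear_okubo_polar]
  bilinear_lmul[OF bilinear_okubo_polar] bilinear_rmul[OF bilinear_okubo_polar]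
  bilinear_lzero[OF bilinear_okubo_polar] bilinear_rzero[OF bilinear_okubo_polar]

lemmas okubo_closed [simp] =
  subspace_0[OF subspace_okubo] subspace_add[OF subspace_okubo] subspace_diff[OF subspace_okubo]
  subspace_neg[OF subspace_okubo] subspace_scale[OF subspace_okubo] okubo_mult_closed

lemma okubo_norm_polar: "okubo_norm x = okubo_polar x x / 2"
  by (simp add: okubo_polar_self)

lemma okubo_norm_scaleR [simp]: "okubo_norm (c *\<^sub>R x) = c\<^sup>2 * okubo_norm x"
  by (simp add: okubo_norm_polar okubo_polar_bilinear power2_eq_square)

lemma okubo_norm_minus [simp]: "okubo_norm (- x) = okubo_norm x"
  by (simp add: okubo_norm_polar okubo_polar_bilinear)

lemma okubo_norm_zero [simp]: "okubo_norm 0 = 0"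
  by (simp add: okubo_norm_eq_0)

lemma okubo_norm_diff: "okubo_norm (x - y) = okubo_norm x + okubo_norm y - okubo_polar x y"
  by (simp add: okubo_norm_polar okubo_polar_bilinear okubo_polar_commute[of y x] field_simps)

lemma okubo_norm_add: "okubo_norm (x + y) = okubo_norm x + okubo_norm y + okubo_polar x y"
  by (simp add: okubo_polar_def)

lemma okubo_mult_eq_0:
  assumes "x \<in> okubo" "y \<in> okubo"
  shows "x \<star> y = 0 \<longleftrightarrow> x = 0 \<or> y = 0"
  using assms okubo_norm_mult[OF assms] okubo_norm_eq_0[of x] okubo_norm_eq_0[of y]
    okubo_norm_eq_0[of "x \<star> y"] by simp

text \<open>The symmetric composition identities exhibit a solution, a multiple of \<open>b \<star> a\<close> or of
  \<open>a \<star> b\<close>; it is unique because a multiplicative definite norm excludes zero divisors.\<close>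
lemma okubo_division:
  assumes a: "a \<in> okubo" "a \<noteq> 0" and b: "b \<in> okubo"
  shows "\<exists>!x. x \<in> okubo \<and> a \<star> x = b" "\<exists>!x. x \<in> okubo \<and> x \<star> a = b"
proof -
  have n: "okubo_norm a \<noteq> 0"
    using a by (simp add: okubo_norm_eq_0)
  have uniq: "x = y" if "x \<in> okubo" "y \<in> okubo" "a \<star> x = a \<star> y \<or> x \<star> a = y \<star> a" for x y
    using that a okubo_mult_eq_0[of a "x - y"] okubo_mult_eq_0[of "x - y" a]
    by (auto simp: okubo_mult_bilinear)
  show "\<exists>!x. x \<in> okubo \<and> a \<star> x = b"
  proof (rule ex1I)
    show "inverse (okubo_norm a) *\<^sub>R (b \<star> a) \<in> okubo \<and> a \<star> (inverse (okubo_norm a) *\<^sub>R (b \<star> a)) = b"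
      using a b n by (simp add: okubo_mult_bilinear okubo_symmetric_composition)
    thus "x = inverse (okubo_norm a) *\<^sub>R (b \<star> a)" if "x \<in> okubo \<and> a \<star> x = b" for x
      using that by (intro uniq) simp_all
  qed
  show "\<exists>!x. x \<in> okubo \<and> x \<star> a = b"
  proof (rule ex1I)
    show "inverse (okubo_norm a) *\<^sub>R (a \<star> b) \<in> okubo \<and> (inverse (okubo_norm a) *\<^sub>R (a \<star> b)) \<star> a = b"
      using a b n by (simp add: okubo_mult_bilinear okubo_symmetric_composition)
    thus "x = inverse (okubo_norm a) *\<^sub>R (a \<star> b)" if "x \<in> okubo \<and> x \<star> a = b" for x
      using that by (intro uniq) simp_all
  qed
qed

lemma okubo_nontrivial: "\<exists>e\<in>okubo. e \<noteq> 0"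
proof
  define e :: mat3 where "e = (\<chi> i j. if i = j then if i = 1 then 1 else if i = 2 then -1 else 0 else 0)"
  show "e \<in> okubo"
    by (rule okuboI) (simp_all add: e_def trace_def sum_3)
  have "e $ 1 $ 1 \<noteq> 0" by (simp add: e_def)
  thus "e \<noteq> 0" by auto
qed

section \<open>The completed affine plane\<close>

text \<open>Lines get their coordinates from the type of points: \<open>Affine s t\<close> stands for \<open>[s, t]\<close>,
  \<open>Slope c\<close> for \<open>[c]\<close>, and \<open>Infinity\<close> for \<open>[\<infinity>]\<close>. With this coding the point set
  also parametrises the lines.\<close>
primrec completed_line :: "completed_point \<Rightarrow> completed_point set" where
  "completed_line (Affine s t) = slope_line s t"
| "completed_line (Slope c) = vertical_line c"
| "completed_line Infinity = line_at_infinity"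

lemma completed_lines_eq: "completed_lines = completed_line ` completed_points"
proof -
  have "completed_line ` {Affine s t | s t. s \<in> okubo \<and> t \<in> okubo} =
      {slope_line s t | s t. s \<in> okubo \<and> t \<in> okubo}"
    by force
  thus ?thesis
    by (simp add: completed_lines_def completed_points_def image_Un image_image)
qed

lemma mem_completed_points [simp]:
  "Affine x y \<in> completed_points \<longleftrightarrow> x \<in> okubo \<and> y \<in> okubo"
  "Slope s \<in> completed_points \<longleftrightarrow> s \<in> okubo"
  "Infinity \<in> completed_points"
  by (auto simp: completed_points_def)

lemma completed_line_subset: "m \<in> completed_points \<Longrightarrow> completed_line m \<subseteq> completed_points"
  by (cases m) (auto simp: slope_line_def vertical_line_def line_at_infinity_def)

text \<open>Incidence of the point (first argument) with the line (second argument), in coordinates.\<close>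
primrec completed_on :: "completed_point \<Rightarrow> completed_point \<Rightarrow> bool" where
  "completed_on (Affine x y) m = (case m of Affine s t \<Rightarrow> y = s \<star> x + t | Slope c \<Rightarrow> x = c | Infinity \<Rightarrow> False)"
| "completed_on (Slope r) m = (case m of Affine s t \<Rightarrow> r = s | Slope c \<Rightarrow> False | Infinity \<Rightarrow> True)"
| "completed_on Infinity m = (case m of Affine s t \<Rightarrow> False | Slope c \<Rightarrow> True | Infinity \<Rightarrow> True)"

lemma mem_completed_line:
  assumes "p \<in> completed_points" "m \<in> completed_points"
  shows "p \<in> completed_line m \<longleftrightarrow> completed_on p m"
  using assms
  by (cases p; cases m) (auto simp: slope_line_def vertical_line_def line_at_infinity_def)

lemma completed_point_ex1I:
  assumes "P m" "\<And>x y. P (Affine x y) \<Longrightarrow> Affine x y = m" "\<And>s. P (Slope s) \<Longrightarrow> Slope s = m"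
    "P Infinity \<Longrightarrow> Infinity = m"
  shows "\<exists>!m. P m"
proof (rule ex1I[of P m])
  fix m' assume "P m'"
  thus "m' = m" using assms(2-) by (cases m') simp_all
qed (fact assms(1))

text \<open>The slope \<open>s\<close> of the joining line is the solution of \<open>s \<star> (x - x') = y - y'\<close>.\<close>
lemma completed_join_affine:
  assumes "x \<in> okubo" "y \<in> okubo" "x' \<in> okubo" "y' \<in> okubo" "x \<noteq> x'"
  shows "\<exists>!m. m \<in> completed_points \<and> completed_on (Affine x y) m \<and> completed_on (Affine x' y') m"
proof -
  obtain s where s: "s \<in> okubo" "s \<star> (x - x') = y - y'"
    and uniq: "\<And>r. r \<in> okubo \<Longrightarrow> r \<star> (x - x') = y - y' \<Longrightarrow> r = s"
    using okubo_division(2)[of "x - x'" "y - y'"] assms by auto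
  show ?thesis
  proof (rule ex1I)
    show "Affine s (y - s \<star> x) \<in> completed_points \<and>
        completed_on (Affine x y) (Affine s (y - s \<star> x)) \<and> completed_on (Affine x' y') (Affine s (y - s \<star> x))"
      using assms s by (simp add: okubo_mult_bilinear algebra_simps)
    show "m = Affine s (y - s \<star> x)"
      if "m \<in> completed_points \<and> completed_on (Affine x y) m \<and> completed_on (Affine x' y') m" for m
    proof (cases m)
      case (Affine r t)
      hence "r = s" using that by (intro uniq) (auto simp: okubo_mult_bilinear)
      thus ?thesis using that Affine by auto
    qed (use that assms in auto)
  qed
qed

lemma completed_join:
  assumes "p \<in> completed_points" "q \<in> completed_points" "p \<noteq> q"
  shows "\<exists>!m. m \<in> completed_points \<and> completed_on p m \<and> completed_on q m"
proof (cases p)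
  case p: (Affine x y)
  show ?thesis
  proof (cases q)
    case (Affine x' y')
    show ?thesis
    proof (cases "x = x'")
      case True
      thus ?thesis using assms p Affine
        by (intro completed_point_ex1I[of _ "Slope x"]) (auto simp: algebra_simps)
    qed (use assms p Affine completed_join_affine in auto)
  next
    case (Slope s)
    thus ?thesis using assms p
      by (intro completed_point_ex1I[of _ "Affine s (y - s \<star> x)"]) (auto simp: algebra_simps)
  next
    case Infinity
    thus ?thesis using assms p
      by (intro completed_point_ex1I[of _ "Slope x"]) (auto simp: algebra_simps)
  qed
next
  case p: (Slope s)
  show ?thesis
  proof (cases q)
    case (Affine x y)
    thus ?thesis using assms p
      by (intro completed_point_ex1I[of _ "Affine s (y - s \<star> x)"]) (auto simp: algebra_simps)
  qed (use assms p in \<open>(intro completed_point_ex1I[of _ Infinity]; auto)+\<close>)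
next
  case p: Infinity
  show ?thesis
  proof (cases q)
    case (Affine x y)
    thus ?thesis using assms p
      by (intro completed_point_ex1I[of _ "Slope x"]) (auto simp: algebra_simps)
  qed (use assms p in \<open>(intro completed_point_ex1I[of _ Infinity]; auto)+\<close>)
qed

text \<open>The abscissa of the intersection is the solution of \<open>(s - s') \<star> x = t' - t\<close>.\<close>
lemma completed_meet_affine:
  assumes "s \<in> okubo" "t \<in> okubo" "s' \<in> okubo" "t' \<in> okubo" "s \<noteq> s'"
  shows "\<exists>!p. p \<in> completed_points \<and> completed_on p (Affine s t) \<and> completed_on p (Affine s' t')"
proof -
  obtain x where x: "x \<in> okubo" "(s - s') \<star> x = t' - t"
    and uniq: "\<And>z. z \<in> okubo \<Longrightarrow> (s - s') \<star> z = t' - t \<Longrightarrow> z = x"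
    using okubo_division(1)[of "s - s'" "t' - t"] assms by auto
  show ?thesis
  proof (rule ex1I)
    show "Affine x (s \<star> x + t) \<in> completed_points \<and>
        completed_on (Affine x (s \<star> x + t)) (Affine s t) \<and> completed_on (Affine x (s \<star> x + t)) (Affine s' t')"
      using assms x by (simp add: okubo_mult_bilinear algebra_simps)
    show "p = Affine x (s \<star> x + t)"
      if "p \<in> completed_points \<and> completed_on p (Affine s t) \<and> completed_on p (Affine s' t')" for p
    proof (cases p)
      case (Affine z y)
      hence "z = x" using that by (intro uniq) (auto simp: okubo_mult_bilinear algebra_simps)
      thus ?thesis using that Affine by auto
    qed (use that assms in auto)
  qed
qed

lemma completed_meet:
  assumes "l \<in> completed_points" "m \<in> completed_points" "l \<noteq> m"
  shows "\<exists>!p. p \<in> completed_points \<and> completed_on p l \<and> completed_on p m"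
proof (cases l)
  case l: (Affine s t)
  show ?thesis
  proof (cases m)
    case (Affine s' t')
    show ?thesis
    proof (cases "s = s'")
      case True
      thus ?thesis using assms l Affine
        by (intro completed_point_ex1I[of _ "Slope s"]) auto
    qed (use assms l Affine completed_meet_affine in auto)
  next
    case (Slope c)
    thus ?thesis using assms l
      by (intro completed_point_ex1I[of _ "Affine c (s \<star> c + t)"]) auto
  next
    case Infinity
    thus ?thesis using assms l
      by (intro completed_point_ex1I[of _ "Slope s"]) auto
  qed
next
  case l: (Slope c)
  show ?thesis
  proof (cases m)
    case (Affine s t)
    thus ?thesis using assms l
      by (intro completed_point_ex1I[of _ "Affine c (s \<star> c + t)"]) auto
  qed (use assms l in \<open>(intro completed_point_ex1I[of _ Infinity]; auto)+\<close>)
next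
  case l: Infinity
  show ?thesis
  proof (cases m)
    case (Affine s t)
    thus ?thesis using assms l
      by (intro completed_point_ex1I[of _ "Slope s"]) auto
  qed (use assms l in \<open>(intro completed_point_ex1I[of _ Infinity]; auto)+\<close>)
qed

text \<open>Joins and intersections come from division. The quadrangle is \<open>(0, 0)\<close>, \<open>(e, e)\<close>, \<open>(0)\<close>,
  \<open>(\<infinity>)\<close> for any \<open>e \<noteq> 0\<close>.\<close>
lemma projective_plane_completed: "projective_plane completed_points completed_lines (\<in>)"
  unfolding projective_plane_def
proof (intro conjI ballI impI)
  fix p q :: completed_point
  assume pq: "p \<in> completed_points" "q \<in> completed_points" "p \<noteq> q"
  obtain m where m: "m \<in> completed_points \<and> completed_on p m \<and> completed_on q m"
    and uniq: "\<forall>m'. m' \<in> completed_points \<and> completed_on p m' \<and> completed_on q m' \<longrightarrow> m' = m"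
    using completed_join[OF pq] by (rule ex1E)
  show "\<exists>!l. l \<in> completed_lines \<and> p \<in> l \<and> q \<in> l"
  proof (rule ex1I)
    show "completed_line m \<in> completed_lines \<and> p \<in> completed_line m \<and> q \<in> completed_line m"
      using m pq by (simp add: completed_lines_eq mem_completed_line)
    fix l assume "l \<in> completed_lines \<and> p \<in> l \<and> q \<in> l"
    then obtain m' where "m' \<in> completed_points" "l = completed_line m'"
        "p \<in> completed_line m'" "q \<in> completed_line m'"
      unfolding completed_lines_eq by blast
    thus "l = completed_line m"
      using uniq pq by (simp add: mem_completed_line)
  qed
next
  fix l m assume "l \<in> completed_lines" "m \<in> completed_lines" "l \<noteq> m"
  then obtain l' m' where lm: "l' \<in> completed_points" "m' \<in> completed_points" "l' \<noteq> m'"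
    and eq: "l = completed_line l'" "m = completed_line m'"
    by (auto simp: completed_lines_eq)
  have "p \<in> completed_points \<and> p \<in> l \<and> p \<in> m \<longleftrightarrow>
      p \<in> completed_points \<and> completed_on p l' \<and> completed_on p m'" for p
    using lm by (auto simp: eq mem_completed_line)
  thus "\<exists>!p. p \<in> completed_points \<and> p \<in> l \<and> p \<in> m"
    using completed_meet[OF lm] by simp
next
  obtain e where e: "e \<in> okubo" "e \<noteq> 0"
    using okubo_nontrivial by blast
  let ?Q = "{Affine 0 0, Affine e e, Slope 0, Infinity}"
  have card: "card ?Q = 4" using e by simp
  have "\<not> (\<exists>l\<in>completed_lines. \<forall>p\<in>T. p \<in> l)" if T: "T \<subseteq> ?Q" "card T = 3" for T
  proof
    assume "\<exists>l\<in>completed_lines. \<forall>p\<in>T. p \<in> l"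
    then obtain m where m: "m \<in> completed_points" "\<And>p. p \<in> T \<Longrightarrow> p \<in> completed_line m"
      by (auto simp: completed_lines_eq)
    have on: "completed_on p m" if "p \<in> T" for p
      using m that T(1) e by (subst mem_completed_line[symmetric]) auto
    \<comment> \<open>Three of the four points are all points but one, \<open>z\<close>; each choice of \<open>z\<close> leaves a triple
      that no type of line contains.\<close>
    have "card (?Q - T) = 1"
      using card T by (simp add: card_Diff_subset finite_subset)
    then obtain z where "?Q - T = {z}"
      by (auto simp: card_1_singleton_iff)
    hence z: "\<And>p. p \<in> ?Q \<Longrightarrow> p \<noteq> z \<Longrightarrow> completed_on p m"
      using on by blast
    show False
      using z[of "Affine 0 0"] z[of "Affine e e"] z[of "Slope 0"] z[of Infinity] e
      by (cases m; cases z) (auto simp: okubo_mult_bilinear split: if_splits)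
  qed
  thus "\<exists>Q\<subseteq>completed_points. card Q = 4 \<and>
      (\<forall>T\<subseteq>Q. card T = 3 \<longrightarrow> \<not> (\<exists>l\<in>completed_lines. \<forall>p\<in>T. p \<in> l))"
    using card e by (intro exI[of _ ?Q]) auto
qed

section \<open>Transport of projective planes along isomorphisms\<close>

lemma incidence_isomorphic_sym:
  assumes "incidence_isomorphic P L I P' L' I'"
  shows "incidence_isomorphic P' L' I' P L I"
proof -
  obtain f g where fg: "bij_betw f P P'" "bij_betw g L L'"
    and I: "\<And>p l. p \<in> P \<Longrightarrow> l \<in> L \<Longrightarrow> I p l \<longleftrightarrow> I' (f p) (g l)"
    using assms unfolding incidence_isomorphic_def by blast
  have "I' p l \<longleftrightarrow> I (inv_into P f p) (inv_into L g l)" if "p \<in> P'" "l \<in> L'" for p l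
    using that fg I[of "inv_into P f p" "inv_into L g l"]
    by (simp add: bij_betw_inv_into_right bij_betwE[OF bij_betw_inv_into])
  thus ?thesis
    unfolding incidence_isomorphic_def using fg[THEN bij_betw_inv_into] by blast
qed

lemma bij_betw_ex1:
  assumes f: "bij_betw f A B" and "\<exists>!x. x \<in> A \<and> P (f x)"
  shows "\<exists>!y. y \<in> B \<and> P y"
proof -
  obtain x where x: "x \<in> A \<and> P (f x)" and uniq: "\<forall>z. z \<in> A \<and> P (f z) \<longrightarrow> z = x"
    using assms(2) by (rule ex1E)
  show ?thesis
  proof (rule ex1I)
    show "f x \<in> B \<and> P (f x)"
      using x f by (simp add: bij_betwE)
    show "y = f x" if y: "y \<in> B \<and> P y" for y
    proof -
      obtain z where z: "z \<in> A" "y = f z"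
        using y f unfolding bij_betw_def by blast
      have "z = x" using y z by (intro uniq[rule_format]) simp
      with z show ?thesis by simp
    qed
  qed
qed

lemma projective_plane_iso:
  assumes "projective_plane P L I" and iso: "incidence_isomorphic P L I P' L' I'"
  shows "projective_plane P' L' I'"
proof -
  obtain f g where f: "bij_betw f P P'" and g: "bij_betw g L L'"
    and I: "\<And>p l. p \<in> P \<Longrightarrow> l \<in> L \<Longrightarrow> I p l \<longleftrightarrow> I' (f p) (g l)"
    using iso unfolding incidence_isomorphic_def by blast
  have P': "P' = f ` P" and L': "L' = g ` L" and inj: "inj_on f P" "inj_on g L"
    using f g by (auto simp: bij_betw_def)
  note plane = assms(1)[unfolded projective_plane_def]
  have join: "\<exists>!l. l \<in> L' \<and> I' p l \<and> I' q l" if pq: "p \<in> P'" "q \<in> P'" "p \<noteq> q" for p q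
  proof -
    obtain p0 q0 where 0: "p0 \<in> P" "q0 \<in> P" "p = f p0" "q = f q0" "p0 \<noteq> q0"
      using pq unfolding P' by blast
    have "l \<in> L \<and> I' p (g l) \<and> I' q (g l) \<longleftrightarrow> l \<in> L \<and> I p0 l \<and> I q0 l" for l
      using 0 I by auto
    thus ?thesis
      using plane[THEN conjunct1] 0 by (intro bij_betw_ex1[OF g]) simp
  qed
  have meet: "\<exists>!p. p \<in> P' \<and> I' p l \<and> I' p m" if lm: "l \<in> L'" "m \<in> L'" "l \<noteq> m" for l m
  proof -
    obtain l0 m0 where 0: "l0 \<in> L" "m0 \<in> L" "l = g l0" "m = g m0" "l0 \<noteq> m0"
      using lm unfolding L' by blast
    have "p \<in> P \<and> I' (f p) l \<and> I' (f p) m \<longleftrightarrow> p \<in> P \<and> I p l0 \<and> I p m0" for p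
      using 0 I by auto
    thus ?thesis
      using plane[THEN conjunct2, THEN conjunct1] 0 by (intro bij_betw_ex1[OF f]) simp
  qed
  obtain Q where Q: "Q \<subseteq> P" "card Q = 4"
    and general: "\<And>T. T \<subseteq> Q \<Longrightarrow> card T = 3 \<Longrightarrow> \<not> (\<exists>l\<in>L. \<forall>p\<in>T. I p l)"
    using plane[THEN conjunct2, THEN conjunct2] by blast
  have "\<not> (\<exists>l\<in>L'. \<forall>p\<in>T'. I' p l)" if T': "T' \<subseteq> f ` Q" "card T' = 3" for T'
  proof -
    obtain T where T: "T \<subseteq> Q" "T' = f ` T"
      using T'(1) by (auto simp: subset_image_iff)
    have "card T = 3"
      using T' T Q inj(1) by (metis card_image inj_on_subset)
    thus ?thesis
      using general[OF T(1)] T Q I unfolding L' by blast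
  qed
  moreover have "card (f ` Q) = 4"
    using Q inj(1) by (metis card_image inj_on_subset)
  ultimately have "\<exists>Q'\<subseteq>P'. card Q' = 4 \<and>
      (\<forall>T\<subseteq>Q'. card T = 3 \<longrightarrow> \<not> (\<exists>l\<in>L'. \<forall>p\<in>T. I' p l))"
    using Q(1) unfolding P' by (intro exI[of _ "f ` Q"]) auto
  thus ?thesis
    unfolding projective_plane_def by (intro conjI ballI impI join meet)
qed

text \<open>When two families of lines share a coordinate set \<open>M\<close> and incidence with corresponding points is the
  same on both sides, the correspondence of lines is well defined and bijective as soon as in
  both structures a line is determined by its points: two coordinates then name the same line
  on one side iff they do on the other. This avoids computing when two coordinates name
  the same line.\<close>
lemma incidence_isomorphic_by_coordinates:
  assumes f: "bij_betw f P P'"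
    and inc: "\<And>p m. p \<in> P \<Longrightarrow> m \<in> M \<Longrightarrow> I p (a m) \<longleftrightarrow> I' (f p) (b m)"
    and ext: "\<And>l m. l \<in> a ` M \<Longrightarrow> m \<in> a ` M \<Longrightarrow> (\<And>p. p \<in> P \<Longrightarrow> I p l \<longleftrightarrow> I p m) \<Longrightarrow> l = m"
    and ext': "\<And>l m. l \<in> b ` M \<Longrightarrow> m \<in> b ` M \<Longrightarrow> (\<And>p. p \<in> P' \<Longrightarrow> I' p l \<longleftrightarrow> I' p m) \<Longrightarrow> l = m"
  shows "incidence_isomorphic P (a ` M) I P' (b ` M) I'"
proof -
  have P': "P' = f ` P" using f by (simp add: bij_betw_def)
  have same: "a m = a m' \<longleftrightarrow> b m = b m'" if "m \<in> M" "m' \<in> M" for m m'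
  proof
    assume "a m = a m'"
    thus "b m = b m'"
      using that inc[of _ m] inc[of _ m'] by (intro ext') (auto simp: P')
  next
    assume "b m = b m'"
    thus "a m = a m'"
      using that inc[of _ m] inc[of _ m'] by (intro ext) auto
  qed
  define g where "g l = b (inv_into M a l)" for l
  have g: "g (a m) = b m" if "m \<in> M" for m
    using that same[of "inv_into M a (a m)" m] by (simp add: g_def inv_into_into f_inv_into_f)
  have "bij_betw g (a ` M) (b ` M)"
    using same by (auto simp: bij_betw_def inj_on_def g image_image)
  moreover have "\<forall>p\<in>P. \<forall>l\<in>a ` M. I p l \<longleftrightarrow> I' (f p) (g l)"
    using inc by (simp add: g)
  ultimately show ?thesis
    unfolding incidence_isomorphic_def using f by blast
qed

section \<open>Veronese coordinates\<close>

definition veronese :: "mat3 \<Rightarrow> mat3 \<Rightarrow> mat3 \<Rightarrow> real \<Rightarrow> real \<Rightarrow> real \<Rightarrow> veronese" where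
  "veronese a b c p q r = (vector [a, b, c], vector [p, q, r])"

lemma veronese_exhaust: obtains a b c p q r where "w = veronese a b c p q r"
proof
  show "w = veronese (fst w $ 1) (fst w $ 2) (fst w $ 3) (snd w $ 1) (snd w $ 2) (snd w $ 3)"
    by (simp add: veronese_def prod_eq_iff vec_eq_iff forall_3)
qed

lemma veronese_eq_iff [simp]:
  "veronese a b c p q r = veronese a' b' c' p' q' r' \<longleftrightarrow>
     a = a' \<and> b = b' \<and> c = c' \<and> p = p' \<and> q = q' \<and> r = r'"
  unfolding veronese_def by (auto simp: vec_eq_iff[of "vector _"] forall_3)

lemma scaleR_veronese [simp]:
  "k *\<^sub>R veronese a b c p q r =
     veronese (k *\<^sub>R a) (k *\<^sub>R b) (k *\<^sub>R c) (k * p) (k * q) (k * r)"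
  unfolding veronese_def by (simp add: vec_eq_iff[of "_ *\<^sub>R vector _"] forall_3)

lemma veronese_eq_0 [simp]:
  "veronese a b c p q r = 0 \<longleftrightarrow> a = 0 \<and> b = 0 \<and> c = 0 \<and> p = 0 \<and> q = 0 \<and> r = 0"
  unfolding veronese_def by (auto simp: zero_prod_def vec_eq_iff[of "vector _"] forall_3)

lemma veronese_mem_vectors:
  "veronese a b c p q r \<in> veronese_vectors \<longleftrightarrow>
     a \<in> okubo \<and> b \<in> okubo \<and> c \<in> okubo \<and>
     p *\<^sub>R a = b \<star> c \<and> q *\<^sub>R b = c \<star> a \<and> r *\<^sub>R c = a \<star> b \<and>
     okubo_norm a = q * r \<and> okubo_norm b = r * p \<and> okubo_norm c = p * q"
  unfolding veronese_def veronese_vectors_def veronese_space_def by (auto simp: forall_3)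

lemma veronese_form_veronese:
  "veronese_form (veronese a b c p q r) (veronese a' b' c' p' q' r') =
     okubo_polar a a' + okubo_polar b b' + okubo_polar c c' + p * p' + q * q' + r * r'"
  unfolding veronese_def veronese_form_def by (simp add: sum_3)

lemma veronese_vectors_scaleR:
  assumes "w \<in> veronese_vectors" shows "k *\<^sub>R w \<in> veronese_vectors"
proof -
  obtain a b c p q r where w: "w = veronese a b c p q r" by (rule veronese_exhaust)
  have "(k * p) *\<^sub>R (k *\<^sub>R a) = k\<^sup>2 *\<^sub>R (p *\<^sub>R a)" "(k * q) *\<^sub>R (k *\<^sub>R b) = k\<^sup>2 *\<^sub>R (q *\<^sub>R b)"
    "(k * r) *\<^sub>R (k *\<^sub>R c) = k\<^sup>2 *\<^sub>R (r *\<^sub>R c)"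
    by (simp_all add: power2_eq_square mult_ac)
  thus ?thesis
    using assms unfolding w scaleR_veronese veronese_mem_vectors
    by (simp add: okubo_mult_bilinear power2_eq_square)
qed

lemma veronese_form_scaleR:
  "veronese_form (k *\<^sub>R v) w = k * veronese_form v w"
  "veronese_form v (k *\<^sub>R w) = k * veronese_form v w"
  by (simp_all add: veronese_form_def okubo_polar_bilinear sum_distrib_left algebra_simps)

lemma mem_veronese_point_self: "w \<in> veronese_point w"
  unfolding veronese_point_def by (auto intro: exI[of _ 1])

lemma veronese_point_scaleR:
  assumes "k \<noteq> 0" shows "veronese_point (k *\<^sub>R w) = veronese_point w"
proof -
  have "c *\<^sub>R w = (c / k) *\<^sub>R (k *\<^sub>R w)" "c *\<^sub>R (k *\<^sub>R w) = (c * k) *\<^sub>R w" for c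
    using assms by simp_all
  thus ?thesis unfolding veronese_point_def by blast
qed

lemma veronese_line_scaleR: "k \<noteq> 0 \<Longrightarrow> veronese_line (k *\<^sub>R w) = veronese_line w"
  by (auto simp: veronese_line_def veronese_form_scaleR)

lemma veronese_point_subset_line:
  assumes "v \<in> veronese_vectors"
  shows "veronese_point v \<subseteq> veronese_line w \<longleftrightarrow> veronese_form v w = 0"
proof
  show "veronese_form v w = 0" if "veronese_point v \<subseteq> veronese_line w"
    using that mem_veronese_point_self[of v] by (auto simp: veronese_line_def)
  show "veronese_point v \<subseteq> veronese_line w" if "veronese_form v w = 0"
    using that assms
    by (auto simp: veronese_point_def veronese_line_def veronese_form_scaleR veronese_vectors_scaleR)
qed

text \<open>The nonzero vectors of a line are those whose points it contains, and zero belongs to every line;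
  so a line is recovered from its points.\<close>
lemma okubic_line_ext:
  assumes "l \<in> okubic_lines" "m \<in> okubic_lines"
    and "\<And>p. p \<in> okubic_points \<Longrightarrow> p \<subseteq> l \<longleftrightarrow> p \<subseteq> m"
  shows "l = m"
proof -
  have mem: "z \<in> l \<longleftrightarrow> z \<in> veronese_vectors \<and> (z = 0 \<or> veronese_point z \<subseteq> l)"
    if l: "l \<in> okubic_lines" for z l
  proof -
    obtain w where w: "l = veronese_line w"
      using l by (auto simp: okubic_lines_def)
    have "veronese_form 0 w = 0"
      using veronese_form_scaleR(1)[of 0 0 w] by simp
    moreover have "0 \<in> veronese_vectors"
      by (simp add: veronese_vectors_def veronese_space_def zero_prod_def okubo_mult_bilinear)
    moreover have "z \<in> l \<longleftrightarrow> z \<in> veronese_vectors \<and> veronese_form z w = 0"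
      by (simp add: w veronese_line_def)
    ultimately show ?thesis
      using veronese_point_subset_line[of z w] by (cases "z = 0") (auto simp: w)
  qed
  show ?thesis
  proof (rule set_eqI)
    fix z
    have "veronese_point z \<subseteq> l \<longleftrightarrow> veronese_point z \<subseteq> m" if "z \<in> veronese_vectors" "z \<noteq> 0"
      using that by (intro assms(3)) (simp add: okubic_points_def)
    thus "z \<in> l \<longleftrightarrow> z \<in> m"
      unfolding mem[OF assms(1), of z] mem[OF assms(2), of z] by blast
  qed
qed

text \<open>The representatives whose last nonzero \<open>\<lambda>\<close>-coordinate is 1.\<close>
primrec point_vector :: "completed_point \<Rightarrow> veronese" where
  "point_vector (Affine x y) = veronese x y (x \<star> y) (okubo_norm y) (okubo_norm x) 1"
| "point_vector (Slope s) = veronese 0 0 s (okubo_norm s) 1 0"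
| "point_vector Infinity = veronese 0 0 0 1 0 0"

text \<open>The poles of the lines, normalised so that the first nonzero \<open>\<lambda>\<close>-coordinate is 1. The signs are those
  for which the form reproduces the norm of a difference.\<close>
primrec line_vector :: "completed_point \<Rightarrow> veronese" where
  "line_vector (Affine s t) = veronese (t \<star> s) (- t) (- s) 1 (okubo_norm s) (okubo_norm t)"
| "line_vector (Slope c) = veronese (- c) 0 0 0 1 (okubo_norm c)"
| "line_vector Infinity = veronese 0 0 0 0 0 1"

lemma point_vector_mem: "p \<in> completed_points \<Longrightarrow> point_vector p \<in> veronese_vectors - {0}"
  by (cases p)
    (auto simp: veronese_mem_vectors okubo_mult_bilinear okubo_symmetric_composition okubo_norm_mult)

lemma line_vector_mem: "m \<in> completed_points \<Longrightarrow> line_vector m \<in> veronese_vectors - {0}"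
  by (cases m)
    (auto simp: veronese_mem_vectors okubo_mult_bilinear okubo_symmetric_composition okubo_norm_mult)

text \<open>Scaling makes the last nonzero \<open>\<lambda>\<close>-coordinate 1. If it is \<open>\<lambda>\<^sub>3\<close>, the equations for
  \<open>x\<^sub>3\<close>, \<open>\<lambda>\<^sub>1\<close>, \<open>\<lambda>\<^sub>2\<close> express these through \<open>x\<^sub>1\<close> and \<open>x\<^sub>2\<close>. If \<open>\<lambda>\<^sub>3 = 0\<close>, then
  \<open>n(x\<^sub>1) = n(x\<^sub>2) = 0\<close>, and definiteness leaves only the points at infinity.\<close>
lemma point_vector_surj:
  assumes "w \<in> veronese_vectors" "w \<noteq> 0"
  obtains p k where "p \<in> completed_points" "k \<noteq> 0" "point_vector p = k *\<^sub>R w"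
proof -
  obtain a b c p q r where w: "w = veronese a b c p q r" by (rule veronese_exhaust)
  have H: "a \<in> okubo" "b \<in> okubo" "c \<in> okubo" "r *\<^sub>R c = a \<star> b"
      "okubo_norm a = q * r" "okubo_norm b = r * p" "okubo_norm c = p * q"
    using assms(1) by (auto simp: w veronese_mem_vectors)
  show thesis
  proof (cases "r = 0")
    case False
    have eq: "point_vector (Affine (inverse r *\<^sub>R a) (inverse r *\<^sub>R b)) = inverse r *\<^sub>R w"
      using False H by (simp add: w okubo_mult_bilinear H(4)[symmetric] power2_eq_square field_simps)
    thus thesis using False H by (intro that[OF _ _ eq]) auto
  next
    case r: True
    hence ab: "a = 0" "b = 0" using H by (auto simp: okubo_norm_eq_0)
    show thesis
    proof (cases "q = 0")
      case False
      have eq: "point_vector (Slope (inverse q *\<^sub>R c)) = inverse q *\<^sub>R w"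
        using False H r ab by (simp add: w power2_eq_square field_simps)
      thus thesis using False H by (intro that[OF _ _ eq]) auto
    next
      case True
      hence "c = 0" using H by (auto simp: okubo_norm_eq_0)
      hence "p \<noteq> 0" "point_vector Infinity = inverse p *\<^sub>R w"
        using True r ab assms(2) by (auto simp: w)
      thus thesis by (intro that[of Infinity "inverse p"]) auto
    qed
  qed
qed

text \<open>The same argument with the roles of \<open>\<lambda>\<^sub>1\<close> and \<open>\<lambda>\<^sub>3\<close> exchanged.\<close>
lemma line_vector_surj:
  assumes "w \<in> veronese_vectors" "w \<noteq> 0"
  obtains m k where "m \<in> completed_points" "k \<noteq> 0" "line_vector m = k *\<^sub>R w"
proof -
  obtain a b c p q r where w: "w = veronese a b c p q r" by (rule veronese_exhaust)
  have H: "a \<in> okubo" "b \<in> okubo" "c \<in> okubo" "p *\<^sub>R a = b \<star> c"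
      "okubo_norm a = q * r" "okubo_norm b = r * p" "okubo_norm c = p * q"
    using assms(1) by (auto simp: w veronese_mem_vectors)
  show thesis
  proof (cases "p = 0")
    case False
    have eq: "line_vector (Affine (- inverse p *\<^sub>R c) (- inverse p *\<^sub>R b)) = inverse p *\<^sub>R w"
      using False H by (simp add: w okubo_mult_bilinear H(4)[symmetric] power2_eq_square field_simps)
    thus thesis using False H by (intro that[OF _ _ eq]) auto
  next
    case p: True
    hence bc: "b = 0" "c = 0" using H by (auto simp: okubo_norm_eq_0)
    show thesis
    proof (cases "q = 0")
      case False
      have eq: "line_vector (Slope (- inverse q *\<^sub>R a)) = inverse q *\<^sub>R w"
        using False H p bc by (simp add: w power2_eq_square field_simps)
      thus thesis using False H by (intro that[OF _ _ eq]) auto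
    next
      case True
      hence "a = 0" using H by (auto simp: okubo_norm_eq_0)
      hence "r \<noteq> 0" "line_vector Infinity = inverse r *\<^sub>R w"
        using True p bc assms(2) by (auto simp: w)
      thus thesis by (intro that[of Infinity "inverse r"]) auto
    qed
  qed
qed

lemma okubic_points_eq: "okubic_points = (\<lambda>p. veronese_point (point_vector p)) ` completed_points"
proof
  show "okubic_points \<subseteq> (\<lambda>p. veronese_point (point_vector p)) ` completed_points"
  proof
    fix P assume "P \<in> okubic_points"
    then obtain w where w: "w \<in> veronese_vectors" "w \<noteq> 0" "P = veronese_point w"
      by (auto simp: okubic_points_def)
    obtain p k where "p \<in> completed_points" "k \<noteq> 0" "point_vector p = k *\<^sub>R w"
      using w(1,2) by (rule point_vector_surj)
    thus "P \<in> (\<lambda>p. veronese_point (point_vector p)) ` completed_points"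
      using w by (intro image_eqI[of _ _ p]) (simp_all add: veronese_point_scaleR)
  qed
qed (use point_vector_mem in \<open>auto simp: okubic_points_def\<close>)

lemma okubic_lines_eq: "okubic_lines = (\<lambda>m. veronese_line (line_vector m)) ` completed_points"
proof
  show "okubic_lines \<subseteq> (\<lambda>m. veronese_line (line_vector m)) ` completed_points"
  proof
    fix l assume "l \<in> okubic_lines"
    then obtain w where w: "w \<in> veronese_vectors" "w \<noteq> 0" "l = veronese_line w"
      by (auto simp: okubic_lines_def)
    obtain m k where "m \<in> completed_points" "k \<noteq> 0" "line_vector m = k *\<^sub>R w"
      using w(1,2) by (rule line_vector_surj)
    thus "l \<in> (\<lambda>m. veronese_line (line_vector m)) ` completed_points"
      using w by (intro image_eqI[of _ _ m]) (simp_all add: veronese_line_scaleR)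
  qed
qed (use line_vector_mem in \<open>auto simp: okubic_lines_def\<close>)

lemma veronese_point_point_vector_inj: "inj_on (\<lambda>p. veronese_point (point_vector p)) completed_points"
proof (rule inj_onI)
  fix p q assume "veronese_point (point_vector p) = veronese_point (point_vector q)"
  hence "point_vector p \<in> veronese_point (point_vector q)"
    using mem_veronese_point_self by blast
  then obtain k where "point_vector p = k *\<^sub>R point_vector q"
    by (auto simp: veronese_point_def)
  thus "p = q" by (cases p; cases q) auto
qed

text \<open>Associativity of the polar form rewrites \<open>\<langle>x, t \<star> s\<rangle>\<close> and \<open>\<langle>x \<star> y, s\<rangle>\<close> as the mixed terms
  \<open>\<langle>s \<star> x, t\<rangle>\<close> and \<open>\<langle>y, s \<star> x\<rangle>\<close> of the norm on the right; the \<open>\<lambda>\<close>-part contributes its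
  square terms.\<close>
lemma veronese_form_affine:
  assumes "x \<in> okubo" "y \<in> okubo" "s \<in> okubo" "t \<in> okubo"
  shows "veronese_form (point_vector (Affine x y)) (line_vector (Affine s t)) =
    okubo_norm (y - (s \<star> x + t))"
proof -
  have "okubo_polar x (t \<star> s) = okubo_polar t (s \<star> x)"
    using assms by (simp only: okubo_polar_commute[of x] okubo_polar_assoc)
  hence 1: "okubo_polar x (t \<star> s) = okubo_polar (s \<star> x) t"
    by (simp only: okubo_polar_commute[of t])
  have "okubo_polar s (x \<star> y) = okubo_polar (s \<star> x) y"
    using assms by (simp only: okubo_polar_assoc)
  hence 2: "okubo_polar (x \<star> y) s = okubo_polar y (s \<star> x)"
    by (simp only: okubo_polar_commute[of s] okubo_polar_commute[of _ y])
  show ?thesis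
    using assms
    by (simp add: veronese_form_veronese okubo_polar_bilinear okubo_norm_diff okubo_norm_add okubo_norm_mult 1 2)
qed

lemma veronese_form_eq_0_iff:
  assumes "p \<in> completed_points" "m \<in> completed_points"
  shows "veronese_form (point_vector p) (line_vector m) = 0 \<longleftrightarrow> p \<in> completed_line m"
proof -
  have "veronese_form (point_vector p) (line_vector m) = 0 \<longleftrightarrow> completed_on p m"
  proof (cases p)
    case p: (Affine x y)
    show ?thesis
    proof (cases m)
      case (Affine s t)
      thus ?thesis using assms p
        by (simp only: veronese_form_affine mem_completed_points) (simp add: okubo_norm_eq_0)
    next
      case (Slope c)
      have "veronese_form (point_vector p) (line_vector m) = okubo_norm (x - c)"
        by (simp add: p Slope veronese_form_veronese okubo_polar_bilinear okubo_norm_diff)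
      thus ?thesis using assms p Slope by (simp add: okubo_norm_eq_0)
    qed (simp add: p veronese_form_veronese okubo_polar_bilinear)
  next
    case p: (Slope r)
    show ?thesis
    proof (cases m)
      case (Affine s t)
      have "veronese_form (point_vector p) (line_vector m) = okubo_norm (r - s)"
        by (simp add: p Affine veronese_form_veronese okubo_polar_bilinear okubo_norm_diff)
      thus ?thesis using assms p Affine by (simp add: okubo_norm_eq_0)
    qed (simp_all add: p veronese_form_veronese okubo_polar_bilinear)
  next
    case Infinity
    thus ?thesis
      by (cases m) (simp_all add: veronese_form_veronese okubo_polar_bilinear)
  qed
  thus ?thesis using assms by (simp add: mem_completed_line)
qed

lemma okubic_isomorphic:
  "incidence_isomorphic completed_points completed_lines (\<in>) okubic_points okubic_lines (\<subseteq>)"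
  unfolding completed_lines_eq okubic_lines_eq
proof (rule incidence_isomorphic_by_coordinates)
  show "bij_betw (\<lambda>p. veronese_point (point_vector p)) completed_points okubic_points"
    using veronese_point_point_vector_inj by (simp add: bij_betw_def okubic_points_eq)
  show "p \<in> completed_line m \<longleftrightarrow> veronese_point (point_vector p) \<subseteq> veronese_line (line_vector m)"
    if "p \<in> completed_points" "m \<in> completed_points" for p m
    using that point_vector_mem[of p] by (simp add: veronese_form_eq_0_iff veronese_point_subset_line)
  show "l = m" if "l \<in> completed_line ` completed_points" "m \<in> completed_line ` completed_points"
      "\<And>p. p \<in> completed_points \<Longrightarrow> p \<in> l \<longleftrightarrow> p \<in> m" for l m
    using that completed_line_subset by blast
  show "l = m" if "l \<in> (\<lambda>m. veronese_line (line_vector m)) ` completed_points"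
      "m \<in> (\<lambda>m. veronese_line (line_vector m)) ` completed_points"
      "\<And>p. p \<in> okubic_points \<Longrightarrow> p \<subseteq> l \<longleftrightarrow> p \<subseteq> m" for l m
    using that by (intro okubic_line_ext) (simp_all add: okubic_lines_eq)
qed

theorem theorem12:
  shows "projective_plane okubic_points okubic_lines (\<subseteq>) \<and>
         incidence_isomorphic okubic_points okubic_lines (\<subseteq>)
           completed_points completed_lines (\<in>)"
  using projective_plane_iso[OF projective_plane_completed okubic_isomorphic]
    incidence_isomorphic_sym[OF okubic_isomorphic] by blast

end
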